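(* For every positive integer $k$ there is $n_0$ such that for all $n \geq n_0$, $s(n, \mathcal{C}_k) \geq \binom{n}{2} - 5k n^{3/2}$. This holds both when Mini moves first and when Max moves first.
   Context: Let $\mathcal{P}$ be a monotone increasing property of graphs on vertex set $[n]$. An edge $e \in \binom{[n]}{2}\setminus E(G)$ is legal with respect to a graph $G \notin \mathcal{P}$ if $G \cup \{e\} \notin \mathcal{P}$. The saturation game $(n,\mathcal{P})$: starting from the empty graph on $[n]$, two players, Mini and Max, alternately add a legal edge to the current graph $G$. The game ends when no legal edge exists, i.e. when $G$ is saturated with respect to $\mathcal{P}$. Max wants to maximize the number of edges of the final graph and Mini wants to minimize it. The score $s(n,\mathcal{P})$ is the number of edges of the final graph under optimal play by both players; it may depend on which player moves first. $\mathcal{C}_k$ denotes the property of being $k$-vertex-connected (on all $n$ vertices). *)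

theory Defs
  imports Complex_Main
begin

text \<open>A graph on a given vertex set is represented by its edge set, a set of two-element
  sets of vertices.\<close>

type_synonym edges = "nat set set"

definition all_edges :: "nat \<Rightarrow> edges" where
  "all_edges n = {e. e \<subseteq> {1..n} \<and> card e = 2}"

definition graph_connected :: "nat set \<Rightarrow> edges \<Rightarrow> bool" where
  "graph_connected V G \<longleftrightarrow> V \<noteq> {} \<and> (\<forall>u\<in>V. \<forall>v\<in>V. (u, v) \<in> {(x, y). {x, y} \<in> G}\<^sup>*)"

definition vertex_connected :: "nat \<Rightarrow> nat set \<Rightarrow> edges \<Rightarrow> bool" where
  "vertex_connected k V G \<longleftrightarrow>
     k < card V \<and> (\<forall>S\<subseteq>V. card S < k \<longrightarrow> graph_connected (V - S) {e \<in> G. e \<inter> S = {}})"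

definition property_C :: "nat \<Rightarrow> nat \<Rightarrow> edges \<Rightarrow> bool" where
  "property_C k n G \<longleftrightarrow> G \<subseteq> all_edges n \<and> vertex_connected k {1..n} G"

lemma property_C_mono:
  assumes "property_C k n G" and "G \<subseteq> H" and "H \<subseteq> all_edges n"
  shows "property_C k n H"
proof -
  have "graph_connected ({1..n} - S) {e \<in> H. e \<inter> S = {}}"
    if "graph_connected ({1..n} - S) {e \<in> G. e \<inter> S = {}}" for S
  proof -
    have "{(x, y). {x, y} \<in> {e \<in> G. e \<inter> S = {}}} \<subseteq> {(x, y). {x, y} \<in> {e \<in> H. e \<inter> S = {}}}"
      using assms(2) by auto
    from rtrancl_mono[OF this] that show ?thesis
      unfolding graph_connected_def by blast
  qed
  with assms show ?thesis
    unfolding property_C_def vertex_connected_def by blast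
qed

definition legal_edges :: "nat \<Rightarrow> (edges \<Rightarrow> bool) \<Rightarrow> edges \<Rightarrow> edges" where
  "legal_edges n P G = {e \<in> all_edges n - G. \<not> P (insert e G)}"

lemma finite_all_edges: "finite (all_edges n)"
  unfolding all_edges_def by (rule finite_subset[of _ "Pow {1..n}"]) auto

lemma finite_legal_edges: "finite (legal_edges n P G)"
  unfolding legal_edges_def using finite_all_edges by simp

datatype player = Mini | Maxi

text \<open>The number of edges of the final graph under optimal play by both players when the
  current graph is \<open>G\<close> and the given player is to move (backward induction).\<close>

function game_value :: "nat \<Rightarrow> (edges \<Rightarrow> bool) \<Rightarrow> player \<Rightarrow> edges \<Rightarrow> nat" where
  "game_value n P p G =
     (if legal_edges n P G = {} then card G
      else case p of
        Maxi \<Rightarrow> Max ((\<lambda>e. game_value n P Mini (insert e G)) ` legal_edges n P G)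
      | Mini \<Rightarrow> Min ((\<lambda>e. game_value n P Maxi (insert e G)) ` legal_edges n P G))"
  by pat_completeness auto

termination
proof (relation "measure (\<lambda>(n, P, p, G). card (all_edges n - G))", goal_cases)
  case 1
  show ?case by simp
next
  case (2 n P p G e)
  then have "all_edges n - insert e G \<subset> all_edges n - G"
    by (auto simp: legal_edges_def)
  then show ?case by (simp add: finite_all_edges psubset_card_mono)
next
  case (3 n P p G e)
  then have "all_edges n - insert e G \<subset> all_edges n - G"
    by (auto simp: legal_edges_def)
  then show ?case by (simp add: finite_all_edges psubset_card_mono)
qed

declare game_value.simps [simp del]

text \<open>\<open>score p n P\<close> is the score of the saturation game \<open>(n, P)\<close> when player \<open>p\<close> moves first.\<close>

definition score :: "player \<Rightarrow> nat \<Rightarrow> (edges \<Rightarrow> bool) \<Rightarrow> nat" where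
  "score p n P = game_value n P p {}"

end

theory Submission
  imports Defs
begin

text \<open>A saturated graph misses exactly the edges between the two sides of some separation by
  fewer than \<open>k\<close> vertices, so Max only has to keep one side of every such separation of size
  \<open>O(k \<surd>n)\<close>. With \<open>m = \<lfloor>\<surd>n\<rfloor>\<close> he first builds a complete bipartite graph between \<open>k\<close> hubs and
  \<open>m\<close> leaves; fewer than \<open>k\<close> vertices cannot remove all hubs, so the remaining leaves lie on the
  side of a surviving hub. From then on, whenever Mini touches an isolated vertex, Max joins such
  a vertex to a leaf, using the leaves cyclically (if Mini touches none, he attaches any isolated
  vertex). An attached vertex on the side without the hub has its leaf in the separator, which
  leaves at most \<open>(k - 1)(n/m + 1)\<close> of them, and every other vertex touched in this stage is the
  partner of an attached one. All of Max's moves are legal because an isolated vertex remains.\<close>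

section \<open>Separations and isolated vertices\<close>

text \<open>\<open>A\<close> and \<open>B\<close> may be empty: an empty side is trivially small,
  and lemmas that need two proper sides take witnesses in them.\<close>

definition separation :: "nat \<Rightarrow> edges \<Rightarrow> nat set \<Rightarrow> nat set \<Rightarrow> nat set \<Rightarrow> bool" where
  "separation n G S A B \<longleftrightarrow> S \<union> A \<union> B = {1..n} \<and> S \<inter> A = {} \<and> S \<inter> B = {} \<and> A \<inter> B = {} \<and>
     (\<forall>a\<in>A. \<forall>b\<in>B. {a, b} \<notin> G)"

definition small_sides :: "nat \<Rightarrow> nat \<Rightarrow> nat \<Rightarrow> edges \<Rightarrow> bool" where
  "small_sides n k c G \<longleftrightarrow>
     (\<forall>S A B. separation n G S A B \<longrightarrow> card S < k \<longrightarrow> card A \<le> c \<or> card B \<le> c)"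

definition isolated :: "nat \<Rightarrow> edges \<Rightarrow> nat set" where
  "isolated n G = {1..n} - \<Union>G"

lemma psubset_insertI: "a \<notin> A \<Longrightarrow> A \<subset> insert a A"
  by blast

lemma separation_antimono: "separation n H S A B \<Longrightarrow> G \<subseteq> H \<Longrightarrow> separation n G S A B"
  unfolding separation_def by (meson subsetD)

text \<open>New edges can only destroy separations. Hence small sides, once reached, survive every
  continuation of the game.\<close>

lemma small_sides_mono: "small_sides n k c G \<Longrightarrow> G \<subseteq> H \<Longrightarrow> small_sides n k c H"
  unfolding small_sides_def using separation_antimono by meson

lemma separation_commute: "separation n G S A B \<Longrightarrow> separation n G S B A"
  unfolding separation_def by (simp add: ac_simps) (metis insert_commute)

lemma finite_isolated [simp]: "finite (isolated n G)"
  by (simp add: isolated_def)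

lemma all_edges_mem: "{u, v} \<in> all_edges n \<longleftrightarrow> u \<in> {1..n} \<and> v \<in> {1..n} \<and> u \<noteq> v"
  by (auto simp: all_edges_def card_2_iff doubleton_eq_iff)

lemma all_edgesE:
  assumes "e \<in> all_edges n"
  obtains u v where "e = {u, v}" "u \<in> {1..n}" "v \<in> {1..n}" "u \<noteq> v"
  using assms by (auto simp: all_edges_def card_2_iff)

lemma card_all_edges: "card (all_edges n) = n choose 2"
  unfolding all_edges_def using n_subsets[of "{1..n}" 2] by simp

section \<open>Separations as obstructions to connectivity\<close>

text \<open>A walk that avoids \<open>S\<close> and starts in \<open>A\<close> cannot leave
  \<open>A\<close>, so it never reaches \<open>b\<close>.\<close>

lemma separation_not_property_C:
  assumes sep: "separation n G S A B" and "a \<in> A" "b \<in> B" "card S < k"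
  shows "\<not> property_C k n G"
proof
  assume P: "property_C k n G"
  have VS: "{1..n} - S = A \<union> B"
    using sep unfolding separation_def by blast
  let ?R = "{(x, y). {x, y} \<in> {e \<in> G. e \<inter> S = {}}}"
  have "S \<subseteq> {1..n}" using sep unfolding separation_def by blast
  then have "graph_connected ({1..n} - S) {e \<in> G. e \<inter> S = {}}"
    using P \<open>card S < k\<close> unfolding property_C_def vertex_connected_def by blast
  then have "(a, b) \<in> ?R\<^sup>*"
    using VS assms(2,3) unfolding graph_connected_def by blast
  then have "b \<in> A"
  proof (induction rule: rtrancl_induct)
    case base
    show ?case by fact
  next
    case (step y z)
    then have yz: "{y, z} \<in> G" "z \<notin> S" by auto
    then have "z \<in> {1..n}"
      using P unfolding property_C_def by (meson all_edges_mem subsetD)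
    then have "z \<in> A \<union> B" using VS yz by blast
    then show ?case
      using step.IH yz sep unfolding separation_def by blast
  qed
  then show False using sep assms(3) unfolding separation_def by blast
qed

text \<open>If deleting \<open>S\<close> disconnects \<open>u\<close> from \<open>v\<close>, the
  component of \<open>u\<close> and all other remaining vertices form the two sides. The bound
  \<open>k < n\<close> ensures that the failure comes from such an \<open>S\<close> and not from the
  vertex count.\<close>

lemma not_property_C_separation:
  assumes "\<not> property_C k n G" "G \<subseteq> all_edges n" "k < n"
  obtains S A B a b where "separation n G S A B" "card S < k" "a \<in> A" "b \<in> B"
proof -
  from assms obtain S where S: "S \<subseteq> {1..n}" "card S < k"
    and nc: "\<not> graph_connected ({1..n} - S) {e \<in> G. e \<inter> S = {}}"
    unfolding property_C_def vertex_connected_def by auto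
  let ?R = "{(x, y). {x, y} \<in> {e \<in> G. e \<inter> S = {}}}"
  have "{1..n} - S \<noteq> {}"
  proof
    assume "{1..n} - S = {}"
    then have "S = {1..n}" using S by blast
    then show False using S \<open>k < n\<close> by simp
  qed
  then obtain u v where uv: "u \<in> {1..n} - S" "v \<in> {1..n} - S" "(u, v) \<notin> ?R\<^sup>*"
    using nc unfolding graph_connected_def by blast
  let ?A = "{x \<in> {1..n} - S. (u, x) \<in> ?R\<^sup>*}"
  let ?B = "{x \<in> {1..n} - S. (u, x) \<notin> ?R\<^sup>*}"
  have "{a, b} \<notin> G" if "a \<in> ?A" "b \<in> ?B" for a b
  proof
    assume "{a, b} \<in> G"
    then have "(a, b) \<in> ?R" using that by simp
    with that(1) have "(u, b) \<in> ?R\<^sup>*" by (blast intro: rtrancl.rtrancl_into_rtrancl)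
    with that(2) show False by blast
  qed
  then have "separation n G S ?A ?B"
    using S(1) unfolding separation_def by blast
  moreover have "u \<in> ?A" "v \<in> ?B" using uv by auto
  ultimately show thesis using that S(2) by blast
qed

lemma isolated_not_property_C:
  assumes "isolated n G \<noteq> {}" "k \<ge> 1" "n \<ge> 2"
  shows "\<not> property_C k n G"
proof -
  from assms(1) obtain z where z: "z \<in> {1..n}" "z \<notin> \<Union>G"
    unfolding isolated_def by blast
  then have sep: "separation n G {} {z} ({1..n} - {z})"
    by (auto simp: separation_def)
  have "card ({1..n} - {z}) > 0" using z assms(3) by simp
  then obtain b where "b \<in> {1..n} - {z}" by (metis card_gt_0_iff ex_in_conv)
  with separation_not_property_C[OF sep, of z b k] assms(2) show ?thesis by simp
qed

section \<open>Missing edges of saturated graphs and game values\<close>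

text \<open>Fix one separation. A missing edge not running between \<open>A\<close> and
  \<open>B\<close> would leave it intact, hence be legal; so at most \<open>card A * card B\<close>
  edges are missing, and one factor is at most \<open>c\<close>.\<close>

lemma saturated_card_ge:
  assumes G: "G \<subseteq> all_edges n" and nP: "\<not> property_C k n G" and "k < n"
    and sat: "legal_edges n (property_C k n) G = {}" and small: "small_sides n k c G"
  shows "n choose 2 \<le> card G + n * c"
proof -
  obtain S A B a b where sep: "separation n G S A B" and S: "card S < k" and ab: "a \<in> A" "b \<in> B"
    using not_property_C_separation[OF nP G \<open>k < n\<close>] .
  have sub: "A \<subseteq> {1..n}" "B \<subseteq> {1..n}"
    using sep unfolding separation_def by auto
  then have fin: "finite A" "finite B" by (auto intro: finite_subset)
  have "all_edges n - G \<subseteq> (\<lambda>(x, y). {x, y}) ` (A \<times> B)"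
  proof
    fix e assume e: "e \<in> all_edges n - G"
    show "e \<in> (\<lambda>(x, y). {x, y}) ` (A \<times> B)"
    proof (rule ccontr)
      assume "e \<notin> (\<lambda>(x, y). {x, y}) ` (A \<times> B)"
      then have "separation n (insert e G) S A B"
        using sep unfolding separation_def by force
      then have "\<not> property_C k n (insert e G)"
        using separation_not_property_C S ab by blast
      then show False using e sat unfolding legal_edges_def by blast
    qed
  qed
  then have "card (all_edges n - G) \<le> card ((\<lambda>(x, y). {x, y}) ` (A \<times> B))"
    using fin by (intro card_mono) auto
  also have "\<dots> \<le> card (A \<times> B)" using fin by (intro card_image_le) auto
  also have "\<dots> = card A * card B" by (simp add: card_cartesian_product)
  also have "\<dots> \<le> n * c"
  proof -
    have "card A \<le> n" "card B \<le> n"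
      using card_mono[OF _ sub(1)] card_mono[OF _ sub(2)] by auto
    moreover have "card A \<le> c \<or> card B \<le> c"
      using small sep S unfolding small_sides_def by blast
    ultimately show ?thesis by (metis mult.commute mult_le_mono)
  qed
  finally have "card (all_edges n - G) \<le> n * c" .
  moreover have "card (all_edges n - G) = (n choose 2) - card G"
    using G finite_all_edges by (simp add: card_Diff_subset finite_subset card_all_edges)
  ultimately show ?thesis by simp
qed

lemma game_value_Maxi_ge:
  assumes "e \<in> legal_edges n P G" "b \<le> game_value n P Mini (insert e G)"
  shows "b \<le> game_value n P Maxi G"
proof -
  have "game_value n P Mini (insert e G) \<le>
      Max ((\<lambda>e. game_value n P Mini (insert e G)) ` legal_edges n P G)"
    using assms(1) finite_legal_edges by (intro Max_ge) auto
  then show ?thesis using assms by (subst game_value.simps) auto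
qed

lemma game_value_Mini_ge:
  assumes "legal_edges n P G \<noteq> {}"
    and "\<And>e. e \<in> legal_edges n P G \<Longrightarrow> b \<le> game_value n P Maxi (insert e G)"
  shows "b \<le> game_value n P Mini G"
  using assms by (subst game_value.simps) (auto simp: finite_legal_edges)

text \<open>From here Max needs no strategy: whatever both players do, the sides stay small until
  saturation.\<close>

lemma game_value_small_sides:
  assumes "G \<subseteq> all_edges n" "\<not> property_C k n G" "k < n" "small_sides n k c G"
  shows "(n choose 2) - n * c \<le> game_value n (property_C k n) p G"
  using assms
proof (induction "card (all_edges n - G)" arbitrary: G p rule: less_induct)
  case less
  let ?L = "legal_edges n (property_C k n) G"
  show ?case
  proof (cases "?L = {}")
    case True
    then show ?thesis
      using saturated_card_ge[OF less.prems(1,2,3) True less.prems(4)]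
      by (subst game_value.simps) simp
  next
    case False
    have step: "(n choose 2) - n * c \<le> game_value n (property_C k n) q (insert e G)"
      if e: "e \<in> ?L" for e q
    proof (rule less.hyps)
      have "all_edges n - insert e G \<subset> all_edges n - G"
        using e by (auto simp: legal_edges_def)
      then show "card (all_edges n - insert e G) < card (all_edges n - G)"
        by (simp add: finite_all_edges psubset_card_mono)
      show "small_sides n k c (insert e G)"
        using less.prems(4) by (rule small_sides_mono) auto
    qed (use e less.prems in \<open>auto simp: legal_edges_def\<close>)
    show ?thesis
    proof (cases p)
      case Mini
      then show ?thesis using game_value_Mini_ge[OF False] step by blast
    next
      case Maxi
      then show ?thesis using False game_value_Maxi_ge step by (metis ex_in_conv)
    qed
  qed
qed

text \<open>An index is determined by its residue and its quotient, and the quotient is at most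
  \<open>t div m\<close>. This will bound how often the leaves in a separator are used.\<close>

lemma card_mod_mem_le:
  fixes m t :: nat
  assumes "finite J" "m > 0"
  shows "card {i. i < t \<and> i mod m \<in> J} \<le> card J * (t div m + 1)"
proof -
  have "{i. i < t \<and> i mod m \<in> J} \<subseteq> (\<lambda>(j, q). q * m + j) ` (J \<times> {..t div m})"
  proof
    fix i assume "i \<in> {i. i < t \<and> i mod m \<in> J}"
    then have "(i mod m, i div m) \<in> J \<times> {..t div m}" by (auto intro: div_le_mono)
    moreover have "i = (\<lambda>(j, q). q * m + j) (i mod m, i div m)" by simp
    ultimately show "i \<in> (\<lambda>(j, q). q * m + j) ` (J \<times> {..t div m})" by (rule rev_image_eqI)
  qed
  then have "card {i. i < t \<and> i mod m \<in> J} \<le> card ((\<lambda>(j, q). q * m + j) ` (J \<times> {..t div m}))"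
    using assms(1) by (intro card_mono) auto
  also have "\<dots> \<le> card (J \<times> {..t div m})" using assms(1) by (intro card_image_le) auto
  finally show ?thesis by (simp add: card_cartesian_product)
qed

section \<open>Hubs, leaves and attached vertices\<close>

text \<open>In \<open>n_large\<close>, the first two summands bound the vertices touched while the
  hubs are built: two for each of at most \<open>k * m + 1\<close> other edges, plus hubs and
  leaves. The \<open>4\<close> leaves enough isolated vertices to start attaching.\<close>

locale connectivity_game =
  fixes k m n :: nat
  assumes k_pos: "k \<ge> 1" and m_pos: "m \<ge> 1" and n_large: "2 * (k * m + 1) + (k + m) + 4 \<le> n"
begin

abbreviation property :: "edges \<Rightarrow> bool" where
  "property \<equiv> property_C k n"

definition hub_edges :: edges where
  "hub_edges = (\<lambda>(h, w). {h, w}) ` ({1..k} \<times> {k+1..k+m})"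

definition leaf :: "nat \<Rightarrow> nat" where
  "leaf i = k + 1 + i mod m"

text \<open>The summands pay, in order, for vertices touched during building, for attached vertices
  and partners whose leaf is in the separator (hence the factor 2), for partners of attached
  vertices in the separator, and for up to three isolated vertices.\<close>

definition side_bound :: nat where
  "side_bound = 2 * (k * m + 1) + (k + m) + 2 * ((k - 1) * (n div m + 1)) + (k - 1) + 3"

text \<open>\<open>x i\<close> is the \<open>i\<close>-th attached vertex and \<open>p i\<close> the vertex that Mini touched together with it,
  or \<open>leaf i\<close> if there is none; \<open>F\<close> contains the vertices touched while the hubs were built.\<close>

definition attachment :: "nat set \<Rightarrow> edges \<Rightarrow> nat \<Rightarrow> (nat \<Rightarrow> nat) \<Rightarrow> (nat \<Rightarrow> nat) \<Rightarrow> bool" where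
  "attachment F G t x p \<longleftrightarrow> hub_edges \<subseteq> G \<and> G \<subseteq> all_edges n \<and> inj_on x {..<t} \<and>
     (\<forall>i<t. {x i, leaf i} \<in> G \<and> {x i, p i} \<in> G) \<and>
     {1..n} \<subseteq> F \<union> x ` {..<t} \<union> p ` {..<t} \<union> isolated n G \<and>
     t + card (isolated n G) \<le> n"

lemma n_gt: "k < n" "n \<ge> 2"
  using n_large by auto

lemma leaf_bounds: "leaf i \<in> {k+1..k+m}" "leaf i \<in> {1..n}"
proof -
  have "i mod m < m" using m_pos by simp
  then show "leaf i \<in> {k+1..k+m}" unfolding leaf_def by auto
  then show "leaf i \<in> {1..n}" using n_large by auto
qed

lemma hub_edges_mem: "h \<in> {1..k} \<Longrightarrow> {h, leaf i} \<in> hub_edges"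
  unfolding hub_edges_def using leaf_bounds(1)[of i] by force

lemma hub_edges_subset: "hub_edges \<subseteq> all_edges n"
  unfolding hub_edges_def using n_large by (auto simp: all_edges_mem)

lemma Union_hub_edges: "\<Union>hub_edges \<subseteq> {1..k+m}"
  unfolding hub_edges_def by auto

lemma card_hub_edges: "card hub_edges \<le> k * m"
proof -
  have "card hub_edges \<le> card ({1..k} \<times> {k+1..k+m})"
    unfolding hub_edges_def by (intro card_image_le) auto
  then show ?thesis by (simp add: card_cartesian_product)
qed

lemma leaf_not_isolated:
  assumes "hub_edges \<subseteq> G"
  shows "leaf i \<notin> isolated n G"
proof -
  have "{1, leaf i} \<in> G" using hub_edges_mem[of 1 i] k_pos assms by auto
  then show ?thesis by (auto simp: isolated_def)
qed

section \<open>Small sides after the attachment stage\<close>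

lemma side_without_hub_small:
  assumes att: "attachment F G t x p" and F: "finite F" "card F \<le> 2 * (k * m + 1) + (k + m)"
    and iso: "card (isolated n G) \<le> 3"
    and sep: "separation n G S A B" and S: "card S < k" and h: "h \<in> {1..k}" "h \<in> A"
  shows "card B \<le> side_bound"
proof -
  have hub: "hub_edges \<subseteq> G" and GE: "G \<subseteq> all_edges n" and inj: "inj_on x {..<t}"
    and edge: "\<And>i. i < t \<Longrightarrow> {x i, leaf i} \<in> G" "\<And>i. i < t \<Longrightarrow> {x i, p i} \<in> G"
    and cover: "{1..n} \<subseteq> F \<union> x ` {..<t} \<union> p ` {..<t} \<union> isolated n G"
    and t: "t \<le> n"
    using att unfolding attachment_def by auto
  have V: "S \<union> A \<union> B = {1..n}" and noedge: "\<And>a b. a \<in> A \<Longrightarrow> b \<in> B \<Longrightarrow> {a, b} \<notin> G"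
    using sep unfolding separation_def by auto
  have finS: "finite S" using V by (metis finite_Un finite_atLeastAtMost)
  \<comment> \<open>The surviving hub \<open>h\<close> in \<open>A\<close> is adjacent to every
    leaf.\<close>
  have leafB: "leaf i \<notin> B" for i
    using noedge[OF h(2), of "leaf i"] hub_edges_mem[OF h(1), of i] hub by blast
  define M where "M = {i. i < t \<and> leaf i \<in> S}"
  define N where "N = {i. i < t \<and> x i \<in> S}"
  have finMN: "finite M" "finite N" unfolding M_def N_def by auto
  \<comment> \<open>The leaf of an attached vertex in \<open>B\<close> is in neither
    \<open>A\<close> nor \<open>B\<close>, so the separator contains it.\<close>
  have xB: "i \<in> M" if "i < t" "x i \<in> B" for i
  proof -
    have "leaf i \<notin> A" using noedge[of "leaf i" "x i"] edge(1)[OF that(1)] that(2)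
      by (auto simp: insert_commute)
    then have "leaf i \<in> S" using leafB[of i] leaf_bounds(2)[of i] V by blast
    then show ?thesis using that(1) by (simp add: M_def)
  qed
  \<comment> \<open>The attached vertex next to a partner in \<open>B\<close> is in \<open>B\<close>
    itself, which \<open>xB\<close> handles, or in the separator.\<close>
  have pB: "i \<in> M \<union> N" if "i < t" "p i \<in> B" for i
  proof -
    have "x i \<notin> A" using noedge[of "x i" "p i"] edge(2)[OF that(1)] that(2) by blast
    moreover have "x i \<in> {1..n}" using edge(2)[OF that(1)] GE all_edges_mem by blast
    ultimately have "x i \<in> S \<or> x i \<in> B" using V by blast
    then show ?thesis using xB that(1) by (auto simp: N_def)
  qed
  have "card M \<le> (k - 1) * (n div m + 1)"
  proof -
    \<comment> \<open>Shifting by \<open>k + 1\<close> turns leaves in \<open>S\<close> into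
      residues; dropping the elements of \<open>S\<close> below \<open>k + 1\<close> keeps truncated
      subtraction exact.\<close>
    define J where "J = {j. k + 1 + j \<in> S}"
    have J: "J = (\<lambda>s. s - (k + 1)) ` (S \<inter> {k+1..})"
      unfolding J_def by (force simp: image_iff)
    then have "finite J" using finS by simp
    have "card J \<le> card (S \<inter> {k+1..})" unfolding J using finS by (intro card_image_le) auto
    also have "\<dots> \<le> card S" using finS by (intro card_mono) auto
    finally have "card J \<le> k - 1" using S by simp
    have "card M \<le> card J * (t div m + 1)"
      using card_mod_mem_le[OF \<open>finite J\<close>, of m t] m_pos by (simp add: M_def J_def leaf_def)
    also have "\<dots> \<le> (k - 1) * (n div m + 1)"
      using \<open>card J \<le> k - 1\<close> t by (intro mult_le_mono add_mono div_le_mono) auto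
    finally show ?thesis .
  qed
  \<comment> \<open>Unlike leaves, attached vertices are never repeated, so each element of
    \<open>S\<close> accounts for at most one index.\<close>
  moreover have "card N \<le> k - 1"
  proof -
    have "inj_on x N" using inj by (rule inj_on_subset) (auto simp: N_def)
    moreover have "x ` N \<subseteq> S" by (auto simp: N_def)
    ultimately have "card N \<le> card S" using finS by (intro card_inj_on_le)
    then show ?thesis using S by simp
  qed
  moreover have "card B \<le> card F + card M + (card M + card N) + card (isolated n G)"
  proof -
    have "B \<subseteq> F \<union> x ` M \<union> p ` (M \<union> N) \<union> isolated n G"
    proof
      fix v assume v: "v \<in> B"
      then have "v \<in> F \<union> x ` {..<t} \<union> p ` {..<t} \<union> isolated n G" using cover V by blast
      then show "v \<in> F \<union> x ` M \<union> p ` (M \<union> N) \<union> isolated n G" using xB pB v by blast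
    qed
    then have "card B \<le> card (F \<union> x ` M \<union> p ` (M \<union> N) \<union> isolated n G)"
      using F(1) finMN by (intro card_mono) auto
    also have "\<dots> \<le> card F + card (x ` M) + card (p ` (M \<union> N)) + card (isolated n G)"
      by (meson add_le_mono card_Un_le le_refl le_trans)
    also have "card (x ` M) \<le> card M" using finMN by (intro card_image_le) auto
    also have "card (p ` (M \<union> N)) \<le> card (M \<union> N)" using finMN by (intro card_image_le) auto
    also have "card (M \<union> N) \<le> card M + card N" by (rule card_Un_le)
    finally show ?thesis by simp
  qed
  ultimately show ?thesis using F(2) iso unfolding side_bound_def by linarith
qed

text \<open>Fewer than \<open>k\<close> vertices miss some hub; the side opposite to that hub is the
  small one.\<close>

lemma attachment_small_sides:
  assumes "attachment F G t x p" "finite F" "card F \<le> 2 * (k * m + 1) + (k + m)"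
    and "card (isolated n G) \<le> 3"
  shows "small_sides n k side_bound G"
  unfolding small_sides_def
proof (intro allI impI)
  fix S A B assume sep: "separation n G S A B" and S: "card S < k"
  have "finite S" using sep unfolding separation_def by (metis finite_Un finite_atLeastAtMost)
  then have "\<not> {1..k} \<subseteq> S" using S card_mono[of S "{1..k}"] by auto
  then obtain h where h: "h \<in> {1..k}" "h \<notin> S" by blast
  then have "h \<in> {1..n}" using n_gt by auto
  then have "h \<in> A \<or> h \<in> B" using sep h(2) unfolding separation_def by blast
  then show "card A \<le> side_bound \<or> card B \<le> side_bound"
    using side_without_hub_small[OF assms sep S h(1)]
      side_without_hub_small[OF assms separation_commute[OF sep] S h(1)] by blast
qed

section \<open>Attaching vertices and legality of moves\<close>

text \<open>One update serves both for a lone attachment and for the answer to a move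
  \<open>{u, v}\<close> of Mini. Since only \<open>u\<close> and \<open>v\<close> may cease to be
  isolated, recording both preserves the cover of the vertex set.\<close>

lemma attachment_extend:
  assumes att: "attachment F G t x p" and u: "u \<in> isolated n G"
    and G': "G \<subseteq> G'" "G' \<subseteq> all_edges n" "{u, leaf t} \<in> G'" "{u, v} \<in> G'"
    and iso: "isolated n G \<subseteq> isolated n G' \<union> {u, v}"
  shows "attachment F G' (Suc t) (x(t := u)) (p(t := v))"
proof -
  have "u \<notin> x ` {..<t}"
    using att u unfolding attachment_def isolated_def by blast
  then have "inj_on (x(t := u)) {..<Suc t}"
    using att unfolding attachment_def by (auto simp: inj_on_def less_Suc_eq)
  moreover have "isolated n G' \<subseteq> isolated n G - {u}"
    using G' by (auto simp: isolated_def)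
  then have "card (isolated n G') \<le> card (isolated n G - {u})" by (intro card_mono) auto
  \<comment> \<open>At least \<open>u\<close> stops being isolated, which pays for the increase of
    \<open>t\<close> in the invariant \<open>t + card (isolated n G) \<le> n\<close>.\<close>
  then have "card (isolated n G') < card (isolated n G)"
    using u by (metis card_Diff1_less finite_isolated le_less_trans)
  moreover have "(x(t := u)) ` {..<Suc t} = insert u (x ` {..<t})"
    "(p(t := v)) ` {..<Suc t} = insert v (p ` {..<t})"
    by (auto simp: lessThan_Suc)
  ultimately show ?thesis
    using att G' iso unfolding attachment_def by (auto simp: less_Suc_eq)
qed

text \<open>With no partner, \<open>leaf t\<close> is recorded in its place, so the two required
  edges coincide.\<close>

lemma attachment_attach:
  assumes att: "attachment F G t x p" and u: "u \<in> isolated n G"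
  shows "attachment F (insert {u, leaf t} G) (Suc t) (x(t := u)) (p(t := leaf t))"
    and "{u, leaf t} \<in> all_edges n - G"
    and "isolated n (insert {u, leaf t} G) = isolated n G - {u}"
proof -
  have hub: "hub_edges \<subseteq> G" "G \<subseteq> all_edges n" using att unfolding attachment_def by auto
  have "u \<noteq> leaf t" using u leaf_not_isolated[OF hub(1)] by blast
  then show e: "{u, leaf t} \<in> all_edges n - G"
    using u leaf_bounds(2)[of t] all_edges_mem by (auto simp: isolated_def)
  show iso: "isolated n (insert {u, leaf t} G) = isolated n G - {u}"
    using leaf_not_isolated[OF hub(1), of t] by (auto simp: isolated_def)
  show "attachment F (insert {u, leaf t} G) (Suc t) (x(t := u)) (p(t := leaf t))"
    by (rule attachment_extend[OF att u]) (use e hub iso in auto)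
qed

lemma legal_if_isolated_remain:
  assumes "e \<in> all_edges n - G" "isolated n (insert e G) \<noteq> {}"
  shows "e \<in> legal_edges n property G"
  using assms isolated_not_property_C[OF assms(2) k_pos n_gt(2)] by (simp add: legal_edges_def)

lemma card_isolated_insert:
  assumes "e \<in> all_edges n"
  shows "card (isolated n G) \<le> card (isolated n (insert e G)) + 2"
proof -
  have "card e = 2" using assms by (simp add: all_edges_def)
  then have "finite e" by (metis card.infinite zero_neq_numeral)
  have "isolated n G \<subseteq> isolated n (insert e G) \<union> e" by (auto simp: isolated_def)
  then have "card (isolated n G) \<le> card (isolated n (insert e G) \<union> e)"
    using \<open>finite e\<close> by (intro card_mono) auto
  also have "\<dots> \<le> card (isolated n (insert e G)) + card e" by (rule card_Un_le)
  finally show ?thesis using \<open>card e = 2\<close> by simp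
qed

text \<open>Joining two of three isolated vertices leaves the third one isolated, so this move is
  legal.\<close>

lemma legal_edges_nonempty:
  assumes "card (isolated n G) \<ge> 3"
  shows "legal_edges n property G \<noteq> {}"
proof -
  obtain T where T: "T \<subseteq> isolated n G" "card T = 3"
    using obtain_subset_with_card_n[OF assms] by blast
  obtain a b c where abc: "T = {a, b, c}" "a \<noteq> b" "a \<noteq> c" "b \<noteq> c"
    using T(2) unfolding card_3_iff by blast
  then have iso: "a \<in> isolated n G" "b \<in> isolated n G" "c \<in> isolated n G" using T(1) by auto
  then have "{a, b} \<notin> G" unfolding isolated_def by blast
  moreover have "{a, b} \<in> all_edges n" using iso abc unfolding all_edges_mem isolated_def by blast
  moreover have "c \<in> isolated n (insert {a, b} G)" using iso abc by (simp add: isolated_def)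
  then have "isolated n (insert {a, b} G) \<noteq> {}" by (metis empty_iff)
  ultimately have "{a, b} \<in> legal_edges n property G"
    by (intro legal_if_isolated_remain DiffI)
  then show ?thesis by (metis empty_iff)
qed

text \<open>Max's move when there is nothing to answer. Two isolated vertices are required: one to
  attach, one to keep the move legal. The continuation is a hypothesis so that the lemma applies
  both inside the induction below and on entering this stage.\<close>

lemma game_value_attach:
  assumes att: "attachment F G t x p" and iso: "card (isolated n G) \<ge> 2"
    and next_value: "\<And>H t x p. attachment F H t x p \<Longrightarrow> G \<subset> H \<Longrightarrow> \<not> property H \<Longrightarrow>
      b \<le> game_value n property Mini H"
  shows "b \<le> game_value n property Maxi G"
proof -
  from iso have "isolated n G \<noteq> {}" by auto
  then obtain u where u: "u \<in> isolated n G" by blast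
  note new = attachment_attach[OF att u]
  let ?e = "{u, leaf t}"
  have "card (isolated n (insert ?e G)) \<noteq> 0"
    using new(3) iso u by simp
  then have "isolated n (insert ?e G) \<noteq> {}" by auto
  then have legal: "?e \<in> legal_edges n property G"
    using new(2) legal_if_isolated_remain by blast
  then have "\<not> property (insert ?e G)" by (simp add: legal_edges_def)
  moreover have "G \<subset> insert ?e G" using new(2)
    by (intro psubset_insertI) (simp only: Diff_iff not_False_eq_True)
  ultimately have "b \<le> game_value n property Mini (insert ?e G)"
    by (intro next_value[OF new(1)])
  with legal show ?thesis by (rule game_value_Maxi_ge)
qed

section \<open>The attachment stage of the game\<close>

lemma game_value_attachment:
  assumes "attachment F G t x p" "\<not> property G"
    and F: "finite F" "card F \<le> 2 * (k * m + 1) + (k + m)"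
  shows "(n choose 2) - n * side_bound \<le> game_value n property Mini G"
  using assms(1,2)
proof (induction "card (all_edges n - G)" arbitrary: G t x p rule: less_induct)
  case less
  let ?b = "(n choose 2) - n * side_bound"
  note att = less.prems(1)
  have hub: "hub_edges \<subseteq> G" and GE: "G \<subseteq> all_edges n"
    using att unfolding attachment_def by auto
  have IH: "?b \<le> game_value n property Mini H"
    if "attachment F H t' x' p'" "G \<subset> H" "\<not> property H" for H t' x' p'
  proof (rule less.hyps[OF _ that(1,3)])
    have "H \<subseteq> all_edges n" using that(1) unfolding attachment_def by blast
    then have "all_edges n - H \<subset> all_edges n - G" using that(2) by blast
    then show "card (all_edges n - H) < card (all_edges n - G)"
      by (simp add: finite_all_edges psubset_card_mono)
  qed
  show ?case
  \<comment> \<open>With at least four isolated vertices, Mini's move leaves two, which is enough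
    for Max's reply; with at most three, the sides are already small.\<close>
  proof (cases "card (isolated n G) \<le> 3")
    case True
    then show ?thesis
      using game_value_small_sides[OF GE less.prems(2) n_gt(1)] attachment_small_sides[OF att F]
      by blast
  next
    case False
    show ?thesis
    proof (rule game_value_Mini_ge)
      show "legal_edges n property G \<noteq> {}" using False by (intro legal_edges_nonempty) simp
      fix e assume "e \<in> legal_edges n property G"
      then have e: "e \<in> all_edges n" "e \<notin> G" by (auto simp: legal_edges_def)
      let ?H = "insert e G"
      have HE: "?H \<subseteq> all_edges n" using e GE by blast
      have isoH: "card (isolated n ?H) \<ge> 2"
        using card_isolated_insert[OF e(1), of G] False by simp
      have IH': "?b \<le> game_value n property Mini H'"
        if "attachment F H' t' x' p'" "?H \<subset> H'" "\<not> property H'" for H' t' x' p'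
        using IH[OF that(1) _ that(3)] that(2) by blast
      show "?b \<le> game_value n property Maxi ?H"
      proof (cases "e \<inter> isolated n G = {}")
        case True
        then have "isolated n ?H = isolated n G" by (auto simp: isolated_def)
        then have "attachment F ?H t x p"
          using att HE unfolding attachment_def by auto
        then show ?thesis by (rule game_value_attach[OF _ isoH]) (rule IH')
      next
        case False
        obtain a b where ab: "e = {a, b}" using e(1) by (rule all_edgesE)
        with False have "a \<in> isolated n G \<or> b \<in> isolated n G" by blast
        then obtain u v where uv: "e = {u, v}" "u \<in> isolated n G"
          using ab insert_commute[of a b "{}"] by metis
        show ?thesis
        \<comment> \<open>If \<open>v = leaf t\<close>, Mini has made the intended attachment
          herself and Max attaches another vertex. Otherwise Max replies \<open>{u, leaf t}\<close>
          and \<open>v\<close> becomes the partner of \<open>u\<close>.\<close>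
        proof (cases "v = leaf t")
          case True
          then have "attachment F ?H (Suc t) (x(t := u)) (p(t := leaf t))"
            using attachment_attach(1)[OF att uv(2)] uv(1) by simp
          then show ?thesis by (rule game_value_attach[OF _ isoH]) (rule IH')
        next
          case v: False
          let ?e = "{u, leaf t}"
          have new: "?e \<in> all_edges n - ?H"
            using attachment_attach(2)[OF att uv(2)] v uv(1) by (auto simp: doubleton_eq_iff)
          have iso: "isolated n (insert ?e ?H) = isolated n G - {u, v}"
            using leaf_not_isolated[OF hub, of t] uv(1) by (auto simp: isolated_def)
          have att': "attachment F (insert ?e ?H) (Suc t) (x(t := u)) (p(t := v))"
            by (rule attachment_extend[OF att uv(2)]) (use new HE iso uv(1) in auto)
          \<comment> \<open>Max's reply touches no further isolated vertex, so the two left by Mini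
            remain.\<close>
          have "isolated n ?H = isolated n G - {u, v}"
            using uv(1) by (auto simp: isolated_def)
          then have "card (isolated n (insert ?e ?H)) \<ge> 2" using iso isoH by simp
          then have "isolated n (insert ?e ?H) \<noteq> {}" by auto
          then have legal: "?e \<in> legal_edges n property ?H"
            using new by (intro legal_if_isolated_remain)
          then have "\<not> property (insert ?e ?H)" by (simp add: legal_edges_def)
          moreover have "?H \<subset> insert ?e ?H" using new
            by (intro psubset_insertI) (simp only: Diff_iff not_False_eq_True)
          ultimately have "?b \<le> game_value n property Mini (insert ?e ?H)"
            by (intro IH'[OF att'])
          with legal show ?thesis by (rule game_value_Maxi_ge)
        qed
      qed
    qed
  qed
qed

section \<open>Building the hubs\<close>

lemma building_isolated:
  assumes G: "G \<subseteq> all_edges n" and "card (G - hub_edges) \<le> k * m + 1"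
  defines "F \<equiv> \<Union>(G - hub_edges) \<union> {1..k+m}"
  shows "finite F" "card F \<le> 2 * (k * m + 1) + (k + m)" "{1..n} \<subseteq> F \<union> isolated n G"
    "card (isolated n G) \<ge> 4"
proof -
  have fin: "finite (G - hub_edges)" using G finite_all_edges finite_subset by blast
  have two: "card e = 2" if "e \<in> G - hub_edges" for e
    using that G by (auto simp: all_edges_def)
  have "card (\<Union>(G - hub_edges)) \<le> (\<Sum>e\<in>G - hub_edges. card e)"
    by (rule card_Union_le_sum_card)
  also have "\<dots> = 2 * card (G - hub_edges)" using two by simp
  also have "\<dots> \<le> 2 * (k * m + 1)" using assms(2) by (rule mult_le_mono2)
  finally have "card (\<Union>(G - hub_edges)) \<le> 2 * (k * m + 1)" .
  then show F: "card F \<le> 2 * (k * m + 1) + (k + m)"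
    unfolding F_def by (intro order.trans[OF card_Un_le]) auto
  have "finite e" if "e \<in> G - hub_edges" for e
    using two[OF that] by (metis card.infinite zero_neq_numeral)
  then show "finite F" using fin unfolding F_def by auto
  show cover: "{1..n} \<subseteq> F \<union> isolated n G"
    using Union_hub_edges unfolding F_def isolated_def by blast
  have "n \<le> card (F \<union> isolated n G)"
    using card_mono[OF _ cover] \<open>finite F\<close> by simp
  also have "\<dots> \<le> card F + card (isolated n G)" by (rule card_Un_le)
  finally show "card (isolated n G) \<ge> 4" using F n_large by linarith
qed

text \<open>The potential counts edges outside \<open>hub_edges\<close> plus missing hub edges. Max
  lowers it by one by playing a missing hub edge, and Mini raises it by at most one, so it stays
  within the bound whenever Max is to move.\<close>

lemma game_value_building:
  assumes "G \<subseteq> all_edges n" "card (G - hub_edges) + card (hub_edges - G) \<le> k * m + 1"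
  shows "(n choose 2) - n * side_bound \<le> game_value n property Maxi G"
  using assms
proof (induction "card (all_edges n - G)" arbitrary: G rule: less_induct)
  case less
  let ?b = "(n choose 2) - n * side_bound"
  have le: "card (G - hub_edges) \<le> k * m + 1" using less.prems(2) by simp
  note F = building_isolated[OF less.prems(1) le]
  have finG: "finite G" using less.prems(1) finite_all_edges finite_subset by blast
  have finhub: "finite hub_edges" using hub_edges_subset finite_all_edges finite_subset by blast
  show ?case
  proof (cases "hub_edges \<subseteq> G")
    case True
    have "card (isolated n G) \<le> card {1..n}" by (intro card_mono) (auto simp: isolated_def)
    \<comment> \<open>At \<open>t = 0\<close> the sequences are irrelevant and \<open>id\<close> is
      a placeholder; every touched vertex goes into the exceptional set.\<close>
    then have att: "attachment (\<Union>(G - hub_edges) \<union> {1..k+m}) G 0 id id"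
      using True less.prems(1) F(3) unfolding attachment_def by simp
    show ?thesis
      by (rule game_value_attach[OF att]) (use F game_value_attachment in auto)
  next
    case False
    then obtain e where e: "e \<in> hub_edges - G" by blast
    let ?H = "insert e G"
    have HE: "?H \<subseteq> all_edges n" using e less.prems(1) hub_edges_subset by blast
    have H: "card (?H - hub_edges) + card (hub_edges - ?H) \<le> k * m"
    proof -
      have "?H - hub_edges = G - hub_edges" using e by blast
      moreover have "hub_edges - ?H = (hub_edges - G) - {e}" by blast
      moreover have "card ((hub_edges - G) - {e}) < card (hub_edges - G)"
        using e finhub by (intro card_Diff1_less) auto
      ultimately show ?thesis using less.prems(2) by simp
    qed
    then have isoH: "card (isolated n ?H) \<ge> 4" using building_isolated(4)[OF HE] by simp
    then have "isolated n ?H \<noteq> {}" by auto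
    then have legal: "e \<in> legal_edges n property G"
      using e hub_edges_subset legal_if_isolated_remain by blast
    have "?b \<le> game_value n property Mini ?H"
    proof (rule game_value_Mini_ge)
      show "legal_edges n property ?H \<noteq> {}" using isoH by (intro legal_edges_nonempty) simp
      fix e' assume "e' \<in> legal_edges n property ?H"
      then have e': "e' \<in> all_edges n" "e' \<notin> ?H" by (auto simp: legal_edges_def)
      let ?K = "insert e' ?H"
      show "?b \<le> game_value n property Maxi ?K"
      proof (rule less.hyps)
        have "all_edges n - ?K \<subset> all_edges n - G" using e' by blast
        then show "card (all_edges n - ?K) < card (all_edges n - G)"
          by (simp add: finite_all_edges psubset_card_mono)
        show "?K \<subseteq> all_edges n" using e' HE by blast
        have "card (?K - hub_edges) \<le> card (insert e' (?H - hub_edges))"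
          using finG by (intro card_mono) auto
        also have "\<dots> \<le> card (?H - hub_edges) + 1"
          using finG by (simp add: card_insert_if)
        finally have "card (?K - hub_edges) \<le> card (?H - hub_edges) + 1" .
        moreover have "card (hub_edges - ?K) \<le> card (hub_edges - ?H)"
          using finhub by (intro card_mono) auto
        ultimately show "card (?K - hub_edges) + card (hub_edges - ?K) \<le> k * m + 1"
          using H by linarith
      qed
    qed
    with legal show ?thesis by (rule game_value_Maxi_ge)
  qed
qed

text \<open>The empty graph has potential at most \<open>k * m\<close>; the extra \<open>1\<close>
  in the building bound absorbs an opening move by Mini.\<close>

lemma score_ge: "(n choose 2) - n * side_bound \<le> score p n property"
proof (cases p)
  case Maxi
  then show ?thesis
    unfolding score_def using game_value_building[of "{}"] card_hub_edges by simp
next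
  case Mini
  have "(n choose 2) - n * side_bound \<le> game_value n property Mini {}"
  proof (rule game_value_Mini_ge)
    show "legal_edges n property {} \<noteq> {}"
      using n_large by (intro legal_edges_nonempty) (simp add: isolated_def)
    fix e assume "e \<in> legal_edges n property {}"
    then have e: "e \<in> all_edges n" by (simp add: legal_edges_def)
    have "card ({e} - hub_edges) \<le> card {e}" by (intro card_mono) auto
    moreover have "finite hub_edges" using hub_edges_subset finite_all_edges finite_subset by blast
    then have "card (hub_edges - {e}) \<le> card hub_edges" by (intro card_mono) auto
    ultimately show "(n choose 2) - n * side_bound \<le> game_value n property Maxi {e}"
      using e card_hub_edges by (intro game_value_building) auto
  qed
  then show ?thesis unfolding score_def Mini .
qed

end

section \<open>Choice of the number of leaves and the final estimate\<close>

theorem theorem1p1: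
  fixes k :: nat
  assumes "k \<ge> 1"
  shows "\<exists>n0 :: nat. \<forall>n\<ge>n0. \<forall>first :: player.
           real (score first n (property_C k n)) \<ge> real (n choose 2) - 5 * real k * real n powr (3 / 2)"
proof (intro exI allI impI)
  fix n :: nat and first :: player
  assume n: "(3 * k + 10)\<^sup>2 \<le> n"
  \<comment> \<open>This choice balances the cost of building, of order \<open>k * m\<close>,
    against that of repeated leaves, of order \<open>k * n / m\<close>. The threshold on
    \<open>n\<close> forces \<open>m \<ge> 3 * k + 10\<close>.\<close>
  define m where "m = nat \<lfloor>sqrt (real n)\<rfloor>"
  have m_le: "real m \<le> sqrt (real n)" unfolding m_def by simp
  have "sqrt (real n) < real m + 1" unfolding m_def by linarith
  then have "real n < (real m + 1)\<^sup>2"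
    by (metis of_nat_0_le_iff power_strict_mono real_sqrt_ge_0_iff real_sqrt_pow2 zero_less_numeral)
  then have "real n < real ((m + 1)\<^sup>2)" by (simp add: add.commute)
  then have n_lt: "n < (m + 1)\<^sup>2" by (simp only: of_nat_less_iff)
  have "(3 * k + 10)\<^sup>2 < (m + 1)\<^sup>2" using n n_lt by simp
  then have "3 * k + 10 < m + 1" by (rule power_less_imp_less_base) simp
  then have m_ge: "3 * k + 10 \<le> m" by simp
  have "(real m)\<^sup>2 \<le> (sqrt (real n))\<^sup>2" using m_le by (intro power_mono) auto
  then have "real (m\<^sup>2) \<le> real n" by simp
  then have m2: "m\<^sup>2 \<le> n" by (simp only: of_nat_le_iff)
  have "(3 * k + 10) * m \<le> m\<^sup>2" using m_ge by (simp add: power2_eq_square)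
  then have "3 * (k * m) + 10 * m \<le> n" using m2 by (simp add: algebra_simps)
  then interpret connectivity_game k m n
    using assms m_ge by unfold_locales auto
  \<comment> \<open>Indeed \<open>(m + 1)\<^sup>2\<close> is at most \<open>(m + 3) * m\<close>, as
    \<open>m \<ge> 1\<close>.\<close>
  have "n div m < m + 3"
  proof -
    have "n < (m + 3) * m" using n_lt m_ge by (simp add: power2_eq_square algebra_simps)
    then show ?thesis by (rule less_mult_imp_div_less)
  qed
  \<comment> \<open>Adding \<open>m + 3\<close> to both sides completes \<open>k - 1\<close> to
    \<open>k\<close> and avoids truncated subtraction.\<close>
  then have "(k - 1) * (n div m + 1) + (m + 3) \<le> (k - 1) * (m + 3) + (m + 3)"
    by (intro add_right_mono mult_le_mono) auto
  also have "\<dots> = k * m + 3 * k"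
    using assms by (cases k) (auto simp: algebra_simps)
  finally have "(k - 1) * (n div m + 1) + (m + 3) \<le> k * m + 3 * k" .
  moreover have "k * 9 \<le> k * m" using m_ge by (intro mult_le_mono) auto
  \<comment> \<open>Here \<open>a\<close> stands for \<open>k * m\<close> and \<open>q\<close> for
    \<open>(k - 1) * (n div m + 1)\<close>, which makes the estimate linear. Building and repeated
    leaves give \<open>2 * a\<close> each; the fifth \<open>a\<close> absorbs the lower-order terms,
    at most \<open>8 * k\<close> in total.\<close>
  moreover have "2 * (a + 1) + (k + m) + 2 * q + (k - 1) + 3 \<le> 5 * a"
    if "q + (m + 3) \<le> a + 3 * k" "k * 9 \<le> a" for a q :: nat
    using that by simp
  ultimately have "side_bound \<le> 5 * (k * m)"
    unfolding side_bound_def by blast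
  then have "side_bound \<le> 5 * k * m" by (simp add: mult.assoc)
  then have "real (n * side_bound) \<le> real (n * (5 * k * m))"
    by (simp only: of_nat_le_iff mult_le_mono2)
  also have "\<dots> = 5 * real k * (real n * real m)" by simp
  also have "\<dots> \<le> 5 * real k * (real n * sqrt (real n))"
    using m_le by (intro mult_left_mono) auto
  also have "real n * sqrt (real n) = real n powr (3 / 2)"
  proof -
    have "real n powr (3 / 2) = real n powr (1 + 1 / 2)" by simp
    also have "\<dots> = real n * sqrt (real n)" by (simp only: powr_add) (simp add: powr_half_sqrt)
    finally show ?thesis by simp
  qed
  finally have "real (n * side_bound) \<le> 5 * real k * real n powr (3 / 2)" .
  moreover have "real (n choose 2) \<le> real (score first n (property_C k n)) + real (n * side_bound)"
    using score_ge[of first] by linarith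
  ultimately show "real (n choose 2) - 5 * real k * real n powr (3 / 2) \<le> real (score first n (property_C k n))"
    by linarith
qed

end
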